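(* Let $w$ be an instance of MAXCUT on $n$ vertices and let $(S,\bar S)$ be a maximal cut of $w$ with $\xi(x)\ge\gamma\,\iota(x)$ for every vertex $x$, where $\gamma>\frac{2}{1-\sqrt{1-h(w_{cut})^2}}$. Then the matrix $W+D'$ is positive semidefinite of rank $n-1$.
   Context: An instance of MAXCUT is a vertex set $V=\{1,\dots,n\}$ with a symmetric $w:V\times V\to[0,\infty)$ with zero diagonal and connected support; $W$ is the matrix $W_{ij}=w(i,j)$. A cut $(S,\bar S)$ is maximal if $\sum_{a\in S,b\in\bar S}w(a,b)$ is maximum. For the cut: $\xi(x)$ is the total weight of edges at $x$ crossing the cut, $\iota(x)$ the total weight of edges at $x$ not crossing it. $w_{cut}(u,v)=w(u,v)$ if $u,v$ are on opposite sides of the cut and $0$ otherwise; $w_{uncut}=w-w_{cut}$; $W^{cut},W^{uncut}$ are the corresponding matrices. $D^{cut},D^{uncut}$ are diagonal with $D^{cut}_{ii}=\sum_jW^{cut}_{ij}$, $D^{uncut}_{ii}=\sum_jW^{uncut}_{ij}$, and $D'=D^{cut}-D^{uncut}$. For a weight function $u$, $\tau_u(A)=\sum_{a\in A,b\notin A}u(a,b)$, $\mu_u(A)=\sum_{a\in A,v\in V}u(a,v)$ and the Cheeger constant is $h(u)=\min_{\emptyset\ne A\subsetneq V}\frac{\tau_u(A)}{\min\{\mu_u(A),\mu_u(\bar A)\}}$. *)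

theory Defs
  imports "HOL-Analysis.Analysis"
begin

text \<open>Vertices are the elements of a finite type 'n (so V = UNIV, n = CARD('n)).
  A weight function is w :: 'n => 'n => real.\<close>

definition maxcut_instance :: "('n::finite \<Rightarrow> 'n \<Rightarrow> real) \<Rightarrow> bool" where
  "maxcut_instance w \<longleftrightarrow>
     (\<forall>i j. w i j = w j i) \<and> (\<forall>i j. 0 \<le> w i j) \<and> (\<forall>i. w i i = 0) \<and>
     (\<forall>i j. (\<lambda>a b. 0 < w a b)\<^sup>*\<^sup>* i j)"

definition cut_weight :: "('n::finite \<Rightarrow> 'n \<Rightarrow> real) \<Rightarrow> 'n set \<Rightarrow> real" where
  "cut_weight w S = (\<Sum>a\<in>S. \<Sum>b\<in>-S. w a b)"

definition is_max_cut :: "('n::finite \<Rightarrow> 'n \<Rightarrow> real) \<Rightarrow> 'n set \<Rightarrow> bool" where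
  "is_max_cut w S \<longleftrightarrow> (\<forall>T. cut_weight w T \<le> cut_weight w S)"

definition w_cut :: "('n \<Rightarrow> 'n \<Rightarrow> real) \<Rightarrow> 'n set \<Rightarrow> 'n \<Rightarrow> 'n \<Rightarrow> real" where
  "w_cut w S u v = (if (u \<in> S) \<noteq> (v \<in> S) then w u v else 0)"

definition w_uncut :: "('n \<Rightarrow> 'n \<Rightarrow> real) \<Rightarrow> 'n set \<Rightarrow> 'n \<Rightarrow> 'n \<Rightarrow> real" where
  "w_uncut w S u v = w u v - w_cut w S u v"

text \<open>xi(x): total weight of cut edges at x; iota(x): total weight of uncut edges at x.\<close>
definition xi :: "('n::finite \<Rightarrow> 'n \<Rightarrow> real) \<Rightarrow> 'n set \<Rightarrow> 'n \<Rightarrow> real" where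
  "xi w S x = (\<Sum>y\<in>UNIV. w_cut w S x y)"

definition iota :: "('n::finite \<Rightarrow> 'n \<Rightarrow> real) \<Rightarrow> 'n set \<Rightarrow> 'n \<Rightarrow> real" where
  "iota w S x = (\<Sum>y\<in>UNIV. w_uncut w S x y)"

definition wmat :: "('n::finite \<Rightarrow> 'n \<Rightarrow> real) \<Rightarrow> real^'n^'n" where
  "wmat u = (\<chi> i j. u i j)"

definition degmat :: "('n::finite \<Rightarrow> 'n \<Rightarrow> real) \<Rightarrow> real^'n^'n" where
  "degmat u = (\<chi> i j. if i = j then (\<Sum>k\<in>UNIV. u i k) else 0)"

text \<open>D' = D^cut - D^uncut\<close>
definition Dprime :: "('n::finite \<Rightarrow> 'n \<Rightarrow> real) \<Rightarrow> 'n set \<Rightarrow> real^'n^'n" where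
  "Dprime w S = degmat (w_cut w S) - degmat (w_uncut w S)"

definition tau :: "('n::finite \<Rightarrow> 'n \<Rightarrow> real) \<Rightarrow> 'n set \<Rightarrow> real" where
  "tau u A = (\<Sum>a\<in>A. \<Sum>b\<in>-A. u a b)"

definition mu :: "('n::finite \<Rightarrow> 'n \<Rightarrow> real) \<Rightarrow> 'n set \<Rightarrow> real" where
  "mu u A = (\<Sum>a\<in>A. \<Sum>v\<in>UNIV. u a v)"

definition cheeger :: "('n::finite \<Rightarrow> 'n \<Rightarrow> real) \<Rightarrow> real" where
  "cheeger u = Min ((\<lambda>A. tau u A / min (mu u A) (mu u (-A))) ` {A. A \<noteq> {} \<and> A \<noteq> UNIV})"

definition psd :: "real^'n^'n \<Rightarrow> bool" where
  "psd M \<longleftrightarrow> (\<forall>v. 0 \<le> v \<bullet> (M *v v))"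

end

theory Submission
  imports Defs
begin

text \<open>Put x_i = v_i on S and x_i = -v_i off S, and write c = w_cut, u = w_uncut. Then
  2 v^T (W + D') v = sum c_ij (x_i - x_j)^2 - sum u_ij (x_i - x_j)^2.
  For every m the uncut part is at most 4 sum d^u_i (x_i - m)^2, hence at most
  (4 / gamma) sum d^c_i (x_i - m)^2 since xi >= gamma iota. Choosing m as a weighted median of x,
  the Cheeger inequality bounds the cut part below by 2 (1 - sqrt (1 - h^2)) sum d^c_i (x_i - m)^2,
  so the form is positive unless x is constant, i.e. unless v is a multiple of the sign vector
  of the cut, which lies in the kernel. Maximality of the cut and connectivity make every
  boundary tau_c(A) positive (otherwise flipping A would increase the cut), so h > 0.\<close>

section \<open>Degrees, volumes and boundaries of weighted graphs\<close>

definition wdeg :: "('n::finite \<Rightarrow> 'n \<Rightarrow> real) \<Rightarrow> 'n \<Rightarrow> real" where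
  "wdeg c i = (\<Sum>j\<in>UNIV. c i j)"

lemma mu_eq_sum_wdeg: "mu c A = (\<Sum>a\<in>A. wdeg c a)"
  by (simp add: mu_def wdeg_def)

lemma wdeg_nonneg: "(\<And>i j. 0 \<le> c i j) \<Longrightarrow> 0 \<le> wdeg c i"
  by (simp add: wdeg_def sum_nonneg)

lemma mu_nonneg: "(\<And>i j. 0 \<le> c i j) \<Longrightarrow> 0 \<le> mu c A"
  by (simp add: mu_eq_sum_wdeg wdeg_nonneg sum_nonneg)

lemma mu_mono:
  assumes "\<And>i j. 0 \<le> c i j" and "A \<subseteq> B"
  shows "mu c A \<le> mu c B"
  unfolding mu_eq_sum_wdeg using assms wdeg_nonneg[OF assms(1)] by (intro sum_mono2) auto

lemma mu_add_mu_Compl: "mu c A + mu c (- A) = mu c UNIV"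
  unfolding mu_eq_sum_wdeg by (metis Compl_partition Compl_disjoint finite sum.union_disjoint)

lemma tau_le_mu: "(\<And>i j. 0 \<le> c i j) \<Longrightarrow> tau c A \<le> mu c A"
  unfolding tau_def mu_def by (intro sum_mono sum_mono2) auto

lemma tau_eq_sum_indicator:
  "tau c A = (\<Sum>i\<in>UNIV. \<Sum>j\<in>UNIV. c i j * of_bool (i \<in> A \<and> j \<notin> A))"
proof -
  have "(\<Sum>j\<in>UNIV. c i j * of_bool (i \<in> A \<and> j \<notin> A)) = of_bool (i \<in> A) * (\<Sum>j\<in>-A. c i j)" for i
    by (cases "i \<in> A") (simp_all add: Compl_eq)
  then show ?thesis
    by (simp add: tau_def)
qed

lemma mu_eq_sum_indicator: "mu c A = (\<Sum>i\<in>UNIV. wdeg c i * of_bool (i \<in> A))"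
  by (simp add: mu_eq_sum_wdeg sum.If_cases)

lemma sum_sum_swap_symmetric:
  assumes "\<And>i j. c i j = c j i"
  shows "(\<Sum>i\<in>UNIV. \<Sum>j\<in>UNIV. c i j * F j i) = (\<Sum>i\<in>UNIV. \<Sum>j\<in>UNIV. c i j * F i j)"
  by (subst sum.swap) (simp add: assms)

lemma sum_sum_mult_left_eq_wdeg: "(\<Sum>i\<in>UNIV. \<Sum>j\<in>UNIV. c i j * a i) = (\<Sum>i\<in>UNIV. wdeg c i * a i)"
  by (simp add: wdeg_def sum_distrib_right)

lemma sum_sum_mult_right_eq_wdeg:
  assumes "\<And>i j. c i j = c j i"
  shows "(\<Sum>i\<in>UNIV. \<Sum>j\<in>UNIV. c i j * a j) = (\<Sum>i\<in>UNIV. wdeg c i * a i)"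
  using sum_sum_swap_symmetric[of c "\<lambda>j i. a i", OF assms] by (simp add: sum_sum_mult_left_eq_wdeg)

lemma sum_sum_crossing_eq_tau:
  assumes "\<And>i j. c i j = c j i"
  shows "(\<Sum>i\<in>UNIV. \<Sum>j\<in>UNIV. c i j * of_bool ((i \<in> A) \<noteq> (j \<in> A))) = 2 * tau c A"
proof -
  have "of_bool ((i \<in> A) \<noteq> (j \<in> A)) = of_bool (i \<in> A \<and> j \<notin> A) + (of_bool (j \<in> A \<and> i \<notin> A) :: real)"
    for i j by auto
  then have "(\<Sum>i\<in>UNIV. \<Sum>j\<in>UNIV. c i j * of_bool ((i \<in> A) \<noteq> (j \<in> A)))
      = (\<Sum>i\<in>UNIV. \<Sum>j\<in>UNIV. c i j * of_bool (i \<in> A \<and> j \<notin> A))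
      + (\<Sum>i\<in>UNIV. \<Sum>j\<in>UNIV. c i j * of_bool (j \<in> A \<and> i \<notin> A))"
    by (simp add: distrib_left sum.distrib)
  also have "(\<Sum>i\<in>UNIV. \<Sum>j\<in>UNIV. c i j * of_bool (j \<in> A \<and> i \<notin> A))
      = (\<Sum>i\<in>UNIV. \<Sum>j\<in>UNIV. c i j * of_bool (i \<in> A \<and> j \<notin> A))"
    by (rule sum_sum_swap_symmetric[OF assms])
  finally show ?thesis
    by (simp add: tau_eq_sum_indicator)
qed

lemma sum_sq_diff_eq:
  assumes "\<And>i j. c i j = c j i"
  shows "(\<Sum>i\<in>UNIV. \<Sum>j\<in>UNIV. c i j * (y i - y j)\<^sup>2)
    = 2 * (\<Sum>i\<in>UNIV. wdeg c i * (y i)\<^sup>2) - 2 * (\<Sum>i\<in>UNIV. \<Sum>j\<in>UNIV. c i j * (y i * y j))"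
proof -
  have "c i j * (y i - y j)\<^sup>2 = c i j * (y i)\<^sup>2 + c i j * (y j)\<^sup>2 - 2 * (c i j * (y i * y j))" for i j
    by (simp add: power2_eq_square algebra_simps)
  then show ?thesis
    by (simp add: sum.distrib sum_subtractf sum_distrib_left sum_sum_mult_left_eq_wdeg
        sum_sum_mult_right_eq_wdeg[OF assms])
qed

lemma sum_sq_diff_le_wdeg:
  assumes "\<And>i j. 0 \<le> c i j" and "\<And>i j. c i j = c j i"
  shows "(\<Sum>i\<in>UNIV. \<Sum>j\<in>UNIV. c i j * (y i - y j)\<^sup>2) \<le> 4 * (\<Sum>i\<in>UNIV. wdeg c i * (y i - m)\<^sup>2)"
proof -
  have "(y i - y j)\<^sup>2 \<le> 2 * (y i - m)\<^sup>2 + 2 * (y j - m)\<^sup>2" for i j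
  proof -
    have "2 * (y i - m)\<^sup>2 + 2 * (y j - m)\<^sup>2 = (y i - y j)\<^sup>2 + (y i + y j - 2 * m)\<^sup>2"
      by (simp add: power2_eq_square algebra_simps)
    then show ?thesis by simp
  qed
  then have "c i j * (y i - y j)\<^sup>2 \<le> c i j * (2 * (y i - m)\<^sup>2) + c i j * (2 * (y j - m)\<^sup>2)" for i j
    using mult_left_mono[OF _ assms(1)] by (simp only: flip: distrib_left)
  then have "(\<Sum>i\<in>UNIV. \<Sum>j\<in>UNIV. c i j * (y i - y j)\<^sup>2)
      \<le> (\<Sum>i\<in>UNIV. \<Sum>j\<in>UNIV. c i j * (2 * (y i - m)\<^sup>2) + c i j * (2 * (y j - m)\<^sup>2))"
    by (intro sum_mono)
  also have "\<dots> = (\<Sum>i\<in>UNIV. wdeg c i * (2 * (y i - m)\<^sup>2)) + (\<Sum>i\<in>UNIV. wdeg c i * (2 * (y i - m)\<^sup>2))"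
    by (simp only: sum.distrib sum_sum_mult_left_eq_wdeg sum_sum_mult_right_eq_wdeg[OF assms(2)])
  also have "\<dots> = 4 * (\<Sum>i\<in>UNIV. wdeg c i * (y i - m)\<^sup>2)"
    by (simp add: sum_distrib_left mult.left_commute)
  finally show ?thesis .
qed

section \<open>The Cheeger inequality\<close>

lemma coarea_inequality:
  fixes c :: "'n::finite \<Rightarrow> 'n \<Rightarrow> real" and g :: "'n \<Rightarrow> real"
  assumes "\<And>i. 0 \<le> g i"
    and "\<And>t. 0 \<le> t \<Longrightarrow> h * mu c {u. t < g u} \<le> tau c {u. t < g u}"
  shows "h * (\<Sum>i\<in>UNIV. wdeg c i * g i) \<le> (\<Sum>i\<in>UNIV. \<Sum>j\<in>UNIV. c i j * max (g i - g j) 0)"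
  using assms
proof (induction "card {u. 0 < g u}" arbitrary: g rule: less_induct)
  case less
  define T where "T = {u. 0 < g u}"
  show ?case
  proof (cases "T = {}")
    case True
    then have "g = (\<lambda>u. 0)" using less.prems(1) by (force simp: T_def order_le_less)
    then show ?thesis by simp
  next
    case False
    \<comment> \<open>Peel off the lowest positive level m: g is m on T plus the function max (g - m) 0,
      which has fewer positive values.\<close>
    define m where "m = Min (g ` T)"
    have "m \<in> g ` T"
      unfolding m_def using False by (intro Min_in) auto
    then obtain u0 where u0: "u0 \<in> T" "g u0 = m"
      by blast
    have m_pos: "0 < m" and m_le: "\<And>u. u \<in> T \<Longrightarrow> m \<le> g u"
      using u0 by (auto simp: T_def m_def)
    define g' where "g' u = max (g u - m) 0" for u
    have "{u. 0 < g' u} \<subseteq> T" and "u0 \<notin> {u. 0 < g' u}"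
      using m_pos u0 by (auto simp: g'_def T_def)
    then have "{u. 0 < g' u} \<subset> T"
      using u0(1) by blast
    then have card_less: "card {u. 0 < g' u} < card {u. 0 < g u}"
      by (simp add: T_def psubset_card_mono)
    have "h * mu c {u. t < g' u} \<le> tau c {u. t < g' u}" if "0 \<le> t" for t
    proof -
      have "{u. t < g' u} = {u. t + m < g u}" using that by (auto simp: g'_def)
      then show ?thesis using less.prems(2)[of "t + m"] that m_pos by simp
    qed
    then have IH: "h * (\<Sum>i\<in>UNIV. wdeg c i * g' i) \<le> (\<Sum>i\<in>UNIV. \<Sum>j\<in>UNIV. c i j * max (g' i - g' j) 0)"
      using less.hyps[OF card_less] by (simp add: g'_def)
    have split_g: "g i = m * of_bool (i \<in> T) + g' i" for i
      using m_le[of i] less.prems(1)[of i] m_pos by (auto simp: g'_def T_def max_def)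
    have split_diff: "max (g i - g j) 0 = m * of_bool (i \<in> T \<and> j \<notin> T) + max (g' i - g' j) 0" for i j
      using m_le[of i] m_le[of j] less.prems(1)[of i] less.prems(1)[of j] m_pos
      by (auto simp: g'_def T_def max_def)
    have lhs: "(\<Sum>i\<in>UNIV. wdeg c i * g i) = m * mu c T + (\<Sum>i\<in>UNIV. wdeg c i * g' i)"
      unfolding mu_eq_sum_indicator by (subst split_g) (simp add: algebra_simps sum.distrib sum_distrib_left
          del: sum_mult_of_bool_eq sum_of_bool_mult_eq)
    have rhs: "(\<Sum>i\<in>UNIV. \<Sum>j\<in>UNIV. c i j * max (g i - g j) 0)
        = m * tau c T + (\<Sum>i\<in>UNIV. \<Sum>j\<in>UNIV. c i j * max (g' i - g' j) 0)"
      unfolding split_diff tau_eq_sum_indicator by (simp add: algebra_simps sum.distrib sum_distrib_left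
          del: sum_mult_of_bool_eq sum_of_bool_mult_eq)
    have "h * mu c T \<le> tau c T"
      using less.prems(2)[of 0] by (simp add: T_def)
    then have "m * (h * mu c T) \<le> m * tau c T"
      using m_pos by simp
    then show ?thesis
      using IH unfolding lhs rhs by (simp add: algebra_simps)
  qed
qed

lemma sum_abs_diff_squares_le:
  fixes c :: "'n::finite \<Rightarrow> 'n \<Rightarrow> real"
  assumes "\<And>i j. 0 \<le> c i j"
  shows "(\<Sum>i\<in>UNIV. \<Sum>j\<in>UNIV. c i j * \<bar>(f i)\<^sup>2 - (f j)\<^sup>2\<bar>)\<^sup>2
    \<le> (\<Sum>i\<in>UNIV. \<Sum>j\<in>UNIV. c i j * (f i - f j)\<^sup>2) * (\<Sum>i\<in>UNIV. \<Sum>j\<in>UNIV. c i j * (f i + f j)\<^sup>2)"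
proof -
  have pairs: "(\<Sum>i\<in>UNIV. \<Sum>j\<in>UNIV. F i j) = (\<Sum>p\<in>UNIV. F (fst p) (snd p))" for F :: "'n \<Rightarrow> 'n \<Rightarrow> real"
    by (simp add: sum.cartesian_product case_prod_beta flip: UNIV_Times_UNIV)
  define a where "a p = sqrt (c (fst p) (snd p)) * \<bar>f (fst p) - f (snd p)\<bar>" for p
  define b where "b p = sqrt (c (fst p) (snd p)) * \<bar>f (fst p) + f (snd p)\<bar>" for p
  have "c i j * \<bar>(f i)\<^sup>2 - (f j)\<^sup>2\<bar> = a (i, j) * b (i, j)" for i j
    using assms[of i j]
    by (simp add: a_def b_def power2_eq_square abs_mult[symmetric] algebra_simps real_sqrt_mult[symmetric])
  moreover have "c i j * (f i - f j)\<^sup>2 = (a (i, j))\<^sup>2" and "c i j * (f i + f j)\<^sup>2 = (b (i, j))\<^sup>2" for i j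
    using assms[of i j] by (simp_all add: a_def b_def power_mult_distrib)
  ultimately show ?thesis
    unfolding pairs using Cauchy_Schwarz_ineq_sum[of a b UNIV] by simp
qed

lemma sum_sq_diff_add_sum_sq_add:
  assumes "\<And>i j. c i j = c j i"
  shows "(\<Sum>i\<in>UNIV. \<Sum>j\<in>UNIV. c i j * (f i - f j)\<^sup>2) + (\<Sum>i\<in>UNIV. \<Sum>j\<in>UNIV. c i j * (f i + f j)\<^sup>2)
    = 4 * (\<Sum>i\<in>UNIV. wdeg c i * (f i)\<^sup>2)"
proof -
  have pointwise: "c i j * (f i - f j)\<^sup>2 + c i j * (f i + f j)\<^sup>2 = c i j * (2 * (f i)\<^sup>2) + c i j * (2 * (f j)\<^sup>2)"
    for i j by (simp add: power2_eq_square algebra_simps)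
  have "(\<Sum>i\<in>UNIV. \<Sum>j\<in>UNIV. c i j * (f i - f j)\<^sup>2) + (\<Sum>i\<in>UNIV. \<Sum>j\<in>UNIV. c i j * (f i + f j)\<^sup>2)
      = (\<Sum>i\<in>UNIV. \<Sum>j\<in>UNIV. c i j * (2 * (f i)\<^sup>2) + c i j * (2 * (f j)\<^sup>2))"
    by (simp only: pointwise flip: sum.distrib)
  also have "\<dots> = (\<Sum>i\<in>UNIV. wdeg c i * (2 * (f i)\<^sup>2)) + (\<Sum>i\<in>UNIV. wdeg c i * (2 * (f i)\<^sup>2))"
    by (simp only: sum.distrib sum_sum_mult_left_eq_wdeg sum_sum_mult_right_eq_wdeg[OF assms])
  also have "\<dots> = 4 * (\<Sum>i\<in>UNIV. wdeg c i * (f i)\<^sup>2)"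
    by (simp add: sum_distrib_left mult.left_commute)
  finally show ?thesis .
qed

lemma cheeger_quadratic_bound:
  fixes h N A :: real
  assumes "0 \<le> N" and "(2 * h * N)\<^sup>2 \<le> A * (4 * N - A)"
  shows "2 * (1 - sqrt (1 - h\<^sup>2)) * N \<le> A"
proof -
  have "(2 * N - A)\<^sup>2 \<le> (2 * N)\<^sup>2 * (1 - h\<^sup>2)"
    using assms(2) by (simp add: power2_eq_square algebra_simps)
  then have "sqrt ((2 * N - A)\<^sup>2) \<le> sqrt ((2 * N)\<^sup>2 * (1 - h\<^sup>2))"
    by (rule real_sqrt_le_mono)
  then have "\<bar>2 * N - A\<bar> \<le> 2 * N * sqrt (1 - h\<^sup>2)"
    using assms(1) by (simp add: real_sqrt_mult)
  then show ?thesis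
    by (simp add: algebra_simps)
qed

text \<open>The co-area inequality for f^2 bounds h * N, with N = sum of d_i f_i^2, by half of
  P = sum of c_ij |f_i^2 - f_j^2|; Cauchy-Schwarz gives P^2 <= A B with A = sum of c_ij (f_i - f_j)^2
  and A + B = 4 N, which is a quadratic inequality for A.\<close>

lemma cheeger_inequality_nonneg:
  fixes c :: "'n::finite \<Rightarrow> 'n \<Rightarrow> real" and f :: "'n \<Rightarrow> real"
  assumes c_nonneg: "\<And>i j. 0 \<le> c i j" and c_sym: "\<And>i j. c i j = c j i"
    and f_nonneg: "\<And>i. 0 \<le> f i" and "0 \<le> h"
    and level_sets: "\<And>t. 0 \<le> t \<Longrightarrow> h * mu c {u. t < f u} \<le> tau c {u. t < f u}"
  shows "2 * (1 - sqrt (1 - h\<^sup>2)) * (\<Sum>i\<in>UNIV. wdeg c i * (f i)\<^sup>2)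
    \<le> (\<Sum>i\<in>UNIV. \<Sum>j\<in>UNIV. c i j * (f i - f j)\<^sup>2)"
proof -
  define N where "N = (\<Sum>i\<in>UNIV. wdeg c i * (f i)\<^sup>2)"
  define A where "A = (\<Sum>i\<in>UNIV. \<Sum>j\<in>UNIV. c i j * (f i - f j)\<^sup>2)"
  define B where "B = (\<Sum>i\<in>UNIV. \<Sum>j\<in>UNIV. c i j * (f i + f j)\<^sup>2)"
  define P where "P = (\<Sum>i\<in>UNIV. \<Sum>j\<in>UNIV. c i j * \<bar>(f i)\<^sup>2 - (f j)\<^sup>2\<bar>)"
  have N_nonneg: "0 \<le> N"
    unfolding N_def by (intro sum_nonneg mult_nonneg_nonneg wdeg_nonneg c_nonneg) auto
  have "t < (f u)\<^sup>2 \<longleftrightarrow> sqrt t < f u" for t u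
    using real_sqrt_less_iff[of t "(f u)\<^sup>2"] f_nonneg[of u] by simp
  then have "{u. t < (f u)\<^sup>2} = {u. sqrt t < f u}" for t
    by simp
  then have "h * N \<le> (\<Sum>i\<in>UNIV. \<Sum>j\<in>UNIV. c i j * max ((f i)\<^sup>2 - (f j)\<^sup>2) 0)"
    unfolding N_def using level_sets by (intro coarea_inequality) auto
  also have "\<dots> = P / 2"
  proof -
    have "\<bar>(f i)\<^sup>2 - (f j)\<^sup>2\<bar> = max ((f i)\<^sup>2 - (f j)\<^sup>2) 0 + max ((f j)\<^sup>2 - (f i)\<^sup>2) 0" for i j
      by (simp add: max_def abs_if)
    then have "P = (\<Sum>i\<in>UNIV. \<Sum>j\<in>UNIV. c i j * max ((f i)\<^sup>2 - (f j)\<^sup>2) 0)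
        + (\<Sum>i\<in>UNIV. \<Sum>j\<in>UNIV. c i j * max ((f j)\<^sup>2 - (f i)\<^sup>2) 0)"
      by (simp add: P_def distrib_left sum.distrib)
    moreover have "(\<Sum>i\<in>UNIV. \<Sum>j\<in>UNIV. c i j * max ((f j)\<^sup>2 - (f i)\<^sup>2) 0)
        = (\<Sum>i\<in>UNIV. \<Sum>j\<in>UNIV. c i j * max ((f i)\<^sup>2 - (f j)\<^sup>2) 0)"
      by (rule sum_sum_swap_symmetric[OF c_sym])
    ultimately show ?thesis
      by simp
  qed
  finally have "(2 * h * N)\<^sup>2 \<le> P\<^sup>2"
    using \<open>0 \<le> h\<close> N_nonneg by (intro power_mono) auto
  also have "\<dots> \<le> A * B"
    unfolding P_def A_def B_def by (rule sum_abs_diff_squares_le[OF c_nonneg])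
  also have "A * B = A * (4 * N - A)"
    using sum_sq_diff_add_sum_sq_add[of c f, OF c_sym] by (simp add: A_def B_def N_def)
  finally show ?thesis
    unfolding N_def A_def by (rule cheeger_quadratic_bound[OF N_nonneg[unfolded N_def]])
qed

lemma tau_ge_if_mu_le_half:
  assumes "0 \<le> h"
    and cheeger_bound: "\<And>A. A \<noteq> {} \<Longrightarrow> A \<noteq> UNIV \<Longrightarrow> h * min (mu c A) (mu c (- A)) \<le> tau c A"
    and half: "mu c T \<le> mu c UNIV / 2"
  shows "h * mu c T \<le> tau c T"
proof (cases "T = {} \<or> T = UNIV")
  case True
  with half \<open>0 \<le> h\<close> show ?thesis
    by (auto simp: mu_def tau_def mult_nonneg_nonpos)
next
  case False
  have "min (mu c T) (mu c (- T)) = mu c T"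
    using mu_add_mu_Compl[of c T] half by simp
  with False cheeger_bound[of T] show ?thesis
    by simp
qed

lemma weighted_median_exists:
  fixes c :: "'n::finite \<Rightarrow> 'n \<Rightarrow> real" and x :: "'n \<Rightarrow> real"
  assumes c_nonneg: "\<And>i j. 0 \<le> c i j"
  obtains m where "mu c {u. m < x u} \<le> mu c UNIV / 2" and "mu c {u. x u < m} \<le> mu c UNIV / 2"
proof -
  define Q where "Q = {t \<in> range x. mu c {u. t < x u} \<le> mu c UNIV / 2}"
  define m where "m = Min Q"
  have "x u \<le> Max (range x)" for u
    by simp
  then have none_above: "{u. Max (range x) < x u} = {}"
    by (auto simp: not_less)
  have "mu c {u. Max (range x) < x u} \<le> mu c UNIV / 2"
    using mu_nonneg[of c UNIV, OF c_nonneg] unfolding none_above by (simp add: mu_def)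
  then have "Max (range x) \<in> Q"
    unfolding Q_def by simp
  moreover have "finite Q"
    by (simp add: Q_def)
  ultimately have "m \<in> Q" and m_least: "\<And>t. t \<in> Q \<Longrightarrow> m \<le> t"
    unfolding m_def by (auto intro: Min_in)
  moreover have "mu c {u. x u < m} \<le> mu c UNIV / 2"
  proof (cases "{u. x u < m} = {}")
    case True
    then show ?thesis using mu_nonneg[of c UNIV, OF c_nonneg] by (simp add: mu_def)
  next
    case False
    \<comment> \<open>The largest value t below m is not in Q, so more than half of the volume lies above t.\<close>
    define t where "t = Max (x ` {u. x u < m})"
    have "t \<in> x ` {u. x u < m}"
      unfolding t_def using False by (intro Max_in) auto
    then have "t \<in> range x" and "t < m"
      by auto
    have below_m: "x u \<le> t" if "x u < m" for u
      unfolding t_def using that by (intro Max_ge) auto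
    have "mu c UNIV / 2 < mu c {u. t < x u}"
      using m_least[of t] \<open>t \<in> range x\<close> \<open>t < m\<close> by (force simp: Q_def)
    moreover have "{u. x u < m} = - {u. t < x u}"
      using \<open>t < m\<close> by (auto simp: not_less dest: below_m)
    ultimately show ?thesis
      using mu_add_mu_Compl[of c "{u. t < x u}"] by simp
  qed
  ultimately show ?thesis
    using that[of m] by (simp add: Q_def)
qed

lemma sq_diff_pos_part_add_sq_diff_neg_part_le:
  fixes a b :: real
  shows "(max a 0 - max b 0)\<^sup>2 + (max (- a) 0 - max (- b) 0)\<^sup>2 \<le> (a - b)\<^sup>2"
  by (cases "0 \<le> a"; cases "0 \<le> b")
    (auto simp: max_def power2_eq_square algebra_simps mult_nonneg_nonpos mult_nonpos_nonneg)

lemma cheeger_inequality_pos_part: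
  fixes c :: "'n::finite \<Rightarrow> 'n \<Rightarrow> real" and x :: "'n \<Rightarrow> real"
  assumes c_nonneg: "\<And>i j. 0 \<le> c i j" and c_sym: "\<And>i j. c i j = c j i" and "0 \<le> h"
    and cheeger_bound: "\<And>A. A \<noteq> {} \<Longrightarrow> A \<noteq> UNIV \<Longrightarrow> h * min (mu c A) (mu c (- A)) \<le> tau c A"
    and half: "mu c {u. m < x u} \<le> mu c UNIV / 2"
  shows "2 * (1 - sqrt (1 - h\<^sup>2)) * (\<Sum>i\<in>UNIV. wdeg c i * (max (x i - m) 0)\<^sup>2)
    \<le> (\<Sum>i\<in>UNIV. \<Sum>j\<in>UNIV. c i j * (max (x i - m) 0 - max (x j - m) 0)\<^sup>2)"
proof -
  have "h * mu c {u. t < max (x u - m) 0} \<le> tau c {u. t < max (x u - m) 0}" if "0 \<le> t" for t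
  proof (rule tau_ge_if_mu_le_half[OF \<open>0 \<le> h\<close> cheeger_bound])
    have "{u. t < max (x u - m) 0} \<subseteq> {u. m < x u}"
      using that by auto
    then show "mu c {u. t < max (x u - m) 0} \<le> mu c UNIV / 2"
      using half mu_mono[of c, OF c_nonneg] by (meson order_trans)
  qed
  then show ?thesis
    by (intro cheeger_inequality_nonneg[of c "\<lambda>u. max (x u - m) 0" h, OF c_nonneg c_sym _ \<open>0 \<le> h\<close>]) auto
qed

lemma cheeger_inequality:
  fixes c :: "'n::finite \<Rightarrow> 'n \<Rightarrow> real" and x :: "'n \<Rightarrow> real"
  assumes c_nonneg: "\<And>i j. 0 \<le> c i j" and c_sym: "\<And>i j. c i j = c j i" and "0 \<le> h"
    and cheeger_bound: "\<And>A. A \<noteq> {} \<Longrightarrow> A \<noteq> UNIV \<Longrightarrow> h * min (mu c A) (mu c (- A)) \<le> tau c A"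
  obtains m where "2 * (1 - sqrt (1 - h\<^sup>2)) * (\<Sum>i\<in>UNIV. wdeg c i * (x i - m)\<^sup>2)
    \<le> (\<Sum>i\<in>UNIV. \<Sum>j\<in>UNIV. c i j * (x i - x j)\<^sup>2)"
proof -
  obtain m where upper: "mu c {u. m < x u} \<le> mu c UNIV / 2" and lower: "mu c {u. x u < m} \<le> mu c UNIV / 2"
    using weighted_median_exists[of c, OF c_nonneg] by blast
  define l where "l = 2 * (1 - sqrt (1 - h\<^sup>2))"
  define p where "p i = max (x i - m) 0" for i
  define q where "q i = max (m - x i) 0" for i
  have p_bound: "l * (\<Sum>i\<in>UNIV. wdeg c i * (p i)\<^sup>2) \<le> (\<Sum>i\<in>UNIV. \<Sum>j\<in>UNIV. c i j * (p i - p j)\<^sup>2)"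
    unfolding l_def p_def by (rule cheeger_inequality_pos_part[OF c_nonneg c_sym \<open>0 \<le> h\<close> cheeger_bound upper])
  have q_bound: "l * (\<Sum>i\<in>UNIV. wdeg c i * (q i)\<^sup>2) \<le> (\<Sum>i\<in>UNIV. \<Sum>j\<in>UNIV. c i j * (q i - q j)\<^sup>2)"
    using cheeger_inequality_pos_part[of c h "- m" "\<lambda>u. - x u", OF c_nonneg c_sym \<open>0 \<le> h\<close> cheeger_bound]
      lower
    by (simp add: l_def q_def)
  have "(x i - m)\<^sup>2 = (p i)\<^sup>2 + (q i)\<^sup>2" for i
    by (simp add: p_def q_def max_def power2_eq_square algebra_simps)
  then have "l * (\<Sum>i\<in>UNIV. wdeg c i * (x i - m)\<^sup>2)
      = l * (\<Sum>i\<in>UNIV. wdeg c i * (p i)\<^sup>2) + l * (\<Sum>i\<in>UNIV. wdeg c i * (q i)\<^sup>2)"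
    by (simp add: distrib_left sum.distrib)
  also have "\<dots> \<le> (\<Sum>i\<in>UNIV. \<Sum>j\<in>UNIV. c i j * ((p i - p j)\<^sup>2 + (q i - q j)\<^sup>2))"
    using p_bound q_bound by (simp add: distrib_left sum.distrib)
  also have "\<dots> \<le> (\<Sum>i\<in>UNIV. \<Sum>j\<in>UNIV. c i j * (x i - x j)\<^sup>2)"
    using sq_diff_pos_part_add_sq_diff_neg_part_le[of "x i - m" "x j - m" for i j]
    by (intro sum_mono mult_left_mono c_nonneg) (simp add: p_def q_def)
  finally show ?thesis
    using that l_def by blast
qed

lemma cheeger_mult_min_mu_le_tau:
  assumes c_nonneg: "\<And>i j. 0 \<le> c i j" and "A \<noteq> {}" "A \<noteq> UNIV"
  shows "cheeger c * min (mu c A) (mu c (- A)) \<le> tau c A"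
proof (cases "min (mu c A) (mu c (- A)) = 0")
  case True
  then show ?thesis
    unfolding tau_def using c_nonneg by (simp add: sum_nonneg)
next
  case False
  then have "0 < min (mu c A) (mu c (- A))"
    using mu_nonneg[of c, OF c_nonneg] by (simp add: order_less_le)
  moreover have "cheeger c \<le> tau c A / min (mu c A) (mu c (- A))"
    unfolding cheeger_def using assms(2,3) by (intro Min_le) auto
  ultimately show ?thesis
    by (simp add: pos_le_divide_eq)
qed

lemma cheeger_pos:
  fixes c :: "'n::finite \<Rightarrow> 'n \<Rightarrow> real" and B :: "'n set"
  assumes c_nonneg: "\<And>i j. 0 \<le> c i j"
    and tau_pos: "\<And>A. A \<noteq> {} \<Longrightarrow> A \<noteq> UNIV \<Longrightarrow> 0 < tau c A"
    and "B \<noteq> {}" "B \<noteq> UNIV"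
  shows "0 < cheeger c"
proof -
  let ?ratio = "\<lambda>A. tau c A / min (mu c A) (mu c (- A))"
  have "?ratio B \<in> ?ratio ` {A. A \<noteq> {} \<and> A \<noteq> UNIV}"
    using assms(3,4) by simp
  then have "cheeger c \<in> ?ratio ` {A. A \<noteq> {} \<and> A \<noteq> UNIV}"
    unfolding cheeger_def by (intro Min_in) auto
  then obtain A where A: "A \<noteq> {}" "A \<noteq> UNIV" and cheeger_eq: "cheeger c = ?ratio A"
    by auto
  have "0 < tau c A" and "0 < tau c (- A)"
    using A tau_pos[of A] tau_pos[of "- A"] by auto
  moreover have "tau c A \<le> mu c A" and "tau c (- A) \<le> mu c (- A)"
    using c_nonneg by (simp_all add: tau_le_mu)
  ultimately show ?thesis
    unfolding cheeger_eq by (intro divide_pos_pos) auto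
qed

lemma sum_sq_diff_lt_of_cheeger:
  fixes c u :: "'n::finite \<Rightarrow> 'n \<Rightarrow> real" and x :: "'n \<Rightarrow> real"
  assumes c_nonneg: "\<And>i j. 0 \<le> c i j" and c_sym: "\<And>i j. c i j = c j i"
    and u_nonneg: "\<And>i j. 0 \<le> u i j" and u_sym: "\<And>i j. u i j = u j i"
    and "0 \<le> h"
    and cheeger_bound: "\<And>A. A \<noteq> {} \<Longrightarrow> A \<noteq> UNIV \<Longrightarrow> h * min (mu c A) (mu c (- A)) \<le> tau c A"
    and wdeg_pos: "\<And>i. 0 < wdeg c i"
    and wdeg_le: "\<And>i. \<gamma> * wdeg u i \<le> wdeg c i"
    and gamma_large: "2 < \<gamma> * (1 - sqrt (1 - h\<^sup>2))"
    and "x i \<noteq> x j"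
  shows "(\<Sum>i\<in>UNIV. \<Sum>j\<in>UNIV. u i j * (x i - x j)\<^sup>2) < (\<Sum>i\<in>UNIV. \<Sum>j\<in>UNIV. c i j * (x i - x j)\<^sup>2)"
proof -
  define l where "l = 1 - sqrt (1 - h\<^sup>2)"
  obtain m where cut_bound: "2 * l * (\<Sum>i\<in>UNIV. wdeg c i * (x i - m)\<^sup>2)
      \<le> (\<Sum>i\<in>UNIV. \<Sum>j\<in>UNIV. c i j * (x i - x j)\<^sup>2)"
    using cheeger_inequality[of c h x, OF c_nonneg c_sym \<open>0 \<le> h\<close> cheeger_bound] l_def by blast
  define E where "E = (\<Sum>i\<in>UNIV. wdeg c i * (x i - m)\<^sup>2)"
  have "0 \<le> l"
    unfolding l_def by (simp add: real_sqrt_le_1_iff)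
  moreover have "0 < \<gamma> * l"
    using gamma_large by (simp add: l_def)
  ultimately have "0 < \<gamma>"
    by (auto simp: zero_less_mult_iff)
  obtain k where "x k \<noteq> m"
    using \<open>x i \<noteq> x j\<close> by metis
  then have "0 < wdeg c k * (x k - m)\<^sup>2"
    using wdeg_pos[of k] by simp
  moreover have "0 \<le> wdeg c i * (x i - m)\<^sup>2" for i
    using wdeg_pos[of i] by simp
  ultimately have "0 < E"
    unfolding E_def by (intro sum_pos2[of UNIV k]) auto
  have "\<gamma> * (\<Sum>i\<in>UNIV. \<Sum>j\<in>UNIV. u i j * (x i - x j)\<^sup>2) \<le> \<gamma> * (4 * (\<Sum>i\<in>UNIV. wdeg u i * (x i - m)\<^sup>2))"
    using sum_sq_diff_le_wdeg[of u x m, OF u_nonneg u_sym] \<open>0 < \<gamma>\<close> by simp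
  also have "\<dots> = 4 * (\<Sum>i\<in>UNIV. \<gamma> * wdeg u i * (x i - m)\<^sup>2)"
    by (simp add: sum_distrib_left mult.assoc mult.left_commute)
  also have "\<dots> \<le> 4 * E"
    unfolding E_def using wdeg_le by (intro mult_left_mono sum_mono mult_right_mono) auto
  also have "\<dots> < (2 * (\<gamma> * l)) * E"
    using gamma_large \<open>0 < E\<close> unfolding l_def[symmetric] by (intro mult_strict_right_mono) auto
  also have "\<dots> = \<gamma> * (2 * l * E)"
    by (simp add: ac_simps)
  also have "\<dots> \<le> \<gamma> * (\<Sum>i\<in>UNIV. \<Sum>j\<in>UNIV. c i j * (x i - x j)\<^sup>2)"
    using cut_bound \<open>0 < \<gamma>\<close> unfolding E_def by simp
  finally show ?thesis
    using \<open>0 < \<gamma>\<close> by simp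
qed

section \<open>Maximal cuts\<close>

lemma maxcut_instance_w_cut:
  assumes "maxcut_instance w"
  shows "0 \<le> w_cut w S i j" and "w_cut w S i j = w_cut w S j i"
  using assms by (auto simp: maxcut_instance_def w_cut_def)

lemma maxcut_instance_w_uncut:
  assumes "maxcut_instance w"
  shows "0 \<le> w_uncut w S i j" and "w_uncut w S i j = w_uncut w S j i"
  using assms by (auto simp: maxcut_instance_def w_uncut_def w_cut_def)

lemma tau_pos_if_connected:
  assumes "\<And>i j. 0 \<le> w i j" and "\<And>i j. (\<lambda>a b. 0 < w a b)\<^sup>*\<^sup>* i j"
    and "A \<noteq> {}" and "A \<noteq> UNIV"
  shows "0 < tau w A"
proof -
  obtain i j where "i \<in> A" "j \<notin> A"
    using assms(3,4) by auto
  have "(\<lambda>a b. 0 < w a b)\<^sup>*\<^sup>* i j \<Longrightarrow> i \<in> A \<Longrightarrow> j \<notin> A \<Longrightarrow> \<exists>a\<in>A. \<exists>b\<in>-A. 0 < w a b"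
    by (induction rule: rtranclp_induct) auto
  then obtain a b where "a \<in> A" "b \<in> - A" "0 < w a b"
    using assms(2) \<open>i \<in> A\<close> \<open>j \<notin> A\<close> by blast
  note \<open>0 < w a b\<close>
  also have "w a b \<le> (\<Sum>b\<in>-A. w a b)"
    using \<open>b \<in> - A\<close> assms(1) by (intro member_le_sum) auto
  also have "\<dots> \<le> (\<Sum>a\<in>A. \<Sum>b\<in>-A. w a b)"
    using \<open>a \<in> A\<close> assms(1) by (intro member_le_sum sum_nonneg) auto
  finally show ?thesis
    by (simp add: tau_def)
qed

lemma cut_weight_symdiff:
  assumes w_sym: "\<And>i j. w i j = w j i"
  shows "cut_weight w {x. (x \<in> S) \<noteq> (x \<in> A)} = cut_weight w S + tau (w_uncut w S) A - tau (w_cut w S) A"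
proof -
  let ?T = "{x. (x \<in> S) \<noteq> (x \<in> A)}" and ?c = "w_cut w S" and ?u = "w_uncut w S"
  have c_sym: "?c i j = ?c j i" and u_sym: "?u i j = ?u j i" for i j
    using w_sym by (auto simp: w_cut_def w_uncut_def)
  have cut_weight_eq: "2 * cut_weight w X = (\<Sum>i\<in>UNIV. \<Sum>j\<in>UNIV. w i j * of_bool ((i \<in> X) \<noteq> (j \<in> X)))" for X
    using sum_sum_crossing_eq_tau[of w X, OF w_sym] by (simp add: cut_weight_def tau_def)
  have pointwise: "w i j * of_bool ((i \<in> ?T) \<noteq> (j \<in> ?T))
      = w i j * of_bool ((i \<in> S) \<noteq> (j \<in> S)) + ?u i j * of_bool ((i \<in> A) \<noteq> (j \<in> A))
        - ?c i j * of_bool ((i \<in> A) \<noteq> (j \<in> A))" for i j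
    by (auto simp: w_uncut_def w_cut_def)
  have "2 * cut_weight w ?T = (\<Sum>i\<in>UNIV. \<Sum>j\<in>UNIV. w i j * of_bool ((i \<in> ?T) \<noteq> (j \<in> ?T)))"
    by (rule cut_weight_eq)
  also have "\<dots> = (\<Sum>i\<in>UNIV. \<Sum>j\<in>UNIV. w i j * of_bool ((i \<in> S) \<noteq> (j \<in> S)))
      + (\<Sum>i\<in>UNIV. \<Sum>j\<in>UNIV. ?u i j * of_bool ((i \<in> A) \<noteq> (j \<in> A)))
      - (\<Sum>i\<in>UNIV. \<Sum>j\<in>UNIV. ?c i j * of_bool ((i \<in> A) \<noteq> (j \<in> A)))"
    by (simp only: pointwise sum.distrib sum_subtractf)
  also have "\<dots> = 2 * cut_weight w S + 2 * tau ?u A - 2 * tau ?c A"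
    by (simp only: cut_weight_eq sum_sum_crossing_eq_tau[of ?u A, OF u_sym]
        sum_sum_crossing_eq_tau[of ?c A, OF c_sym])
  finally show ?thesis
    by simp
qed

lemma tau_w_cut_pos:
  assumes "maxcut_instance w" and "is_max_cut w S" and "A \<noteq> {}" and "A \<noteq> UNIV"
  shows "0 < tau (w_cut w S) A"
proof -
  have "tau w A = tau (w_cut w S) A + tau (w_uncut w S) A"
    by (simp add: tau_def w_uncut_def sum_subtractf)
  moreover have "0 < tau w A"
    using assms(1,3,4) by (intro tau_pos_if_connected) (auto simp: maxcut_instance_def)
  moreover have "tau (w_uncut w S) A \<le> tau (w_cut w S) A"
  proof -
    have "cut_weight w {x. (x \<in> S) \<noteq> (x \<in> A)} \<le> cut_weight w S"
      using assms(2) unfolding is_max_cut_def by blast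
    then show ?thesis
      using assms(1) cut_weight_symdiff[of w S A] by (simp add: maxcut_instance_def)
  qed
  ultimately show ?thesis
    by simp
qed

section \<open>The matrix W + D'\<close>

lemma rank_eq_card_minus_one_if_kernel_line:
  fixes M :: "real^'n^'n" and s :: "real^'n"
  assumes "transpose M = M" and "s \<noteq> 0" and "M *v s = 0"
    and kernel: "\<And>v. M *v v = 0 \<Longrightarrow> v \<in> span {s}"
  shows "rank M = CARD('n) - 1"
proof -
  define H where "H = {y. s \<bullet> y = 0}"
  have "range ((*v) M) \<subseteq> H"
  proof
    fix y assume "y \<in> range ((*v) M)"
    then obtain v where "y = M *v v" by blast
    moreover have "s \<bullet> (M *v v) = (transpose M *v s) \<bullet> v"
      by (simp flip: dot_lmul_matrix)
    ultimately show "y \<in> H"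
      using assms(1,3) by (simp add: H_def)
  qed
  moreover have "inj_on ((*v) M) (span H)"
  proof -
    have "y = z" if "y \<in> H" "z \<in> H" "M *v y = M *v z" for y z
    proof -
      have "y - z \<in> span {s}"
        using that(3) by (intro kernel) (simp add: matrix_vector_mult_diff_distrib)
      then obtain t where t: "y - z = t *\<^sub>R s"
        by (auto simp: span_singleton)
      have "t * (s \<bullet> s) = s \<bullet> (y - z)"
        by (simp add: t)
      also have "\<dots> = 0"
        using that(1,2) by (simp add: H_def inner_diff_right)
      finally show ?thesis
        using t \<open>s \<noteq> 0\<close> by simp
    qed
    moreover have "span H = H"
      unfolding H_def by (simp add: span_eq_iff subspace_hyperplane)
    ultimately show ?thesis
      unfolding inj_on_def by blast
  qed
  then have "dim ((*v) M ` H) = dim H"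
    by (rule eucl.dim_image_eq[OF matrix_vector_mul_linear])
  moreover have "dim ((*v) M ` H) \<le> dim (range ((*v) M))"
    by (rule dim_subset) auto
  ultimately have "dim (range ((*v) M)) = dim H"
    using dim_subset[OF \<open>range ((*v) M) \<subseteq> H\<close>] by linarith
  then show ?thesis
    using dim_hyperplane[OF \<open>s \<noteq> 0\<close>] by (simp add: rank_dim_range H_def)
qed

definition cut_sign :: "'n set \<Rightarrow> 'n \<Rightarrow> real" where
  "cut_sign S i = (if i \<in> S then 1 else - 1)"

lemma wmat_Dprime_mult_vec_nth:
  "((wmat w + Dprime w S) *v v) $ i
    = (\<Sum>j\<in>UNIV. w i j * v $ j) + (wdeg (w_cut w S) i - wdeg (w_uncut w S) i) * v $ i"
proof -
  have entry: "(wmat w + Dprime w S) $ i $ j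
      = w i j + (if i = j then wdeg (w_cut w S) i - wdeg (w_uncut w S) i else 0)" for j
    by (simp add: wmat_def Dprime_def degmat_def wdeg_def)
  have "((wmat w + Dprime w S) *v v) $ i
      = (\<Sum>j\<in>UNIV. w i j * v $ j + (if i = j then (wdeg (w_cut w S) i - wdeg (w_uncut w S) i) * v $ j else 0))"
    unfolding matrix_vector_mult_def vec_lambda_beta entry by (intro sum.cong refl) (simp add: algebra_simps)
  then show ?thesis
    by (simp add: sum.distrib)
qed

lemma wmat_Dprime_mult_cut_sign: "(wmat w + Dprime w S) *v (\<chi> i. cut_sign S i) = 0"
proof -
  have "w i j * cut_sign S j = w_uncut w S i j * cut_sign S i - w_cut w S i j * cut_sign S i" for i j
    by (auto simp: cut_sign_def w_cut_def w_uncut_def)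
  then have row_sum: "(\<Sum>j\<in>UNIV. w i j * cut_sign S j)
      = wdeg (w_uncut w S) i * cut_sign S i - wdeg (w_cut w S) i * cut_sign S i" for i
    by (simp add: sum_subtractf wdeg_def sum_distrib_right)
  show ?thesis
    unfolding vec_eq_iff wmat_Dprime_mult_vec_nth vec_lambda_beta row_sum by (simp add: algebra_simps)
qed

lemma wmat_Dprime_quadratic_form:
  fixes w :: "'n::finite \<Rightarrow> 'n \<Rightarrow> real" and x :: "'n \<Rightarrow> real"
  assumes w_sym: "\<And>i j. w i j = w j i" and x: "\<And>i. x i = cut_sign S i * v $ i"
  shows "2 * (v \<bullet> ((wmat w + Dprime w S) *v v))
    = (\<Sum>i\<in>UNIV. \<Sum>j\<in>UNIV. w_cut w S i j * (x i - x j)\<^sup>2)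
      - (\<Sum>i\<in>UNIV. \<Sum>j\<in>UNIV. w_uncut w S i j * (x i - x j)\<^sup>2)"
proof -
  let ?c = "w_cut w S" and ?u = "w_uncut w S"
  have c_sym: "?c i j = ?c j i" and u_sym: "?u i j = ?u j i" for i j
    using w_sym by (auto simp: w_cut_def w_uncut_def)
  have x_sq: "(x i)\<^sup>2 = (v $ i)\<^sup>2" for i
    by (simp add: x cut_sign_def)
  \<comment> \<open>Cut edges join vertices of opposite sign, uncut edges vertices of equal sign.\<close>
  have c_x: "?c i j * (x i * x j) = - (?c i j * (v $ i * v $ j))"
    and u_x: "?u i j * (x i * x j) = ?u i j * (v $ i * v $ j)" for i j
    by (auto simp: x cut_sign_def w_cut_def w_uncut_def)
  have w_split: "w i j * (v $ i * v $ j) = ?c i j * (v $ i * v $ j) + ?u i j * (v $ i * v $ j)" for i j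
    by (simp add: w_uncut_def algebra_simps)
  have form: "v \<bullet> ((wmat w + Dprime w S) *v v)
      = (\<Sum>i\<in>UNIV. \<Sum>j\<in>UNIV. w i j * (v $ i * v $ j)) + (\<Sum>i\<in>UNIV. (wdeg ?c i - wdeg ?u i) * (v $ i)\<^sup>2)"
    unfolding inner_vec_def wmat_Dprime_mult_vec_nth inner_real_def
    by (simp add: sum_distrib_left algebra_simps power2_eq_square flip: sum.distrib)
  have cut: "(\<Sum>i\<in>UNIV. \<Sum>j\<in>UNIV. ?c i j * (x i - x j)\<^sup>2)
      = 2 * (\<Sum>i\<in>UNIV. wdeg ?c i * (v $ i)\<^sup>2) + 2 * (\<Sum>i\<in>UNIV. \<Sum>j\<in>UNIV. ?c i j * (v $ i * v $ j))"
    by (simp add: sum_sq_diff_eq[of ?c x, OF c_sym] x_sq c_x sum_negf)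
  have uncut: "(\<Sum>i\<in>UNIV. \<Sum>j\<in>UNIV. ?u i j * (x i - x j)\<^sup>2)
      = 2 * (\<Sum>i\<in>UNIV. wdeg ?u i * (v $ i)\<^sup>2) - 2 * (\<Sum>i\<in>UNIV. \<Sum>j\<in>UNIV. ?u i j * (v $ i * v $ j))"
    by (simp add: sum_sq_diff_eq[of ?u x, OF u_sym] x_sq u_x)
  have "(\<Sum>i\<in>UNIV. \<Sum>j\<in>UNIV. w i j * (v $ i * v $ j))
      = (\<Sum>i\<in>UNIV. \<Sum>j\<in>UNIV. ?c i j * (v $ i * v $ j)) + (\<Sum>i\<in>UNIV. \<Sum>j\<in>UNIV. ?u i j * (v $ i * v $ j))"
    by (simp only: w_split sum.distrib)
  then show ?thesis
    unfolding form cut uncut by (simp add: left_diff_distrib sum_subtractf)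
qed

lemma mem_span_cut_sign:
  assumes "\<And>i j. cut_sign S i * v $ i = cut_sign S j * v $ j"
  shows "v \<in> span {\<chi> i. cut_sign S i}"
proof -
  have "v $ i = (cut_sign S k * v $ k) * cut_sign S i" for i k
  proof -
    have "cut_sign S i * cut_sign S i = 1"
      by (simp add: cut_sign_def)
    then show ?thesis
      using assms[of k i] by (metis mult.assoc mult.commute mult_1)
  qed
  then have "v = (cut_sign S k * v $ k) *\<^sub>R (\<chi> i. cut_sign S i)" for k
    by (simp add: vec_eq_iff)
  then show ?thesis
    by (metis span_base span_scale singletonI)
qed

lemma transpose_wmat_Dprime:
  assumes "\<And>i j. w i j = w j i"
  shows "transpose (wmat w + Dprime w S) = wmat w + Dprime w S"
  using assms by (simp add: transpose_def wmat_def Dprime_def degmat_def vec_eq_iff w_cut_def w_uncut_def)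

lemma wmat_Dprime_quadratic_form_pos:
  fixes w :: "'n::finite \<Rightarrow> 'n \<Rightarrow> real" and S :: "'n set" and \<gamma> :: real
  assumes mi: "maxcut_instance w" and mc: "is_max_cut w S"
    and xi_ge: "\<And>x. xi w S x \<ge> \<gamma> * iota w S x"
    and gamma_large: "\<gamma> > 2 / (1 - sqrt (1 - (cheeger (w_cut w S))\<^sup>2))"
    and nonconst: "cut_sign S i * v $ i \<noteq> cut_sign S j * v $ j"
  shows "0 < v \<bullet> ((wmat w + Dprime w S) *v v)"
proof -
  let ?c = "w_cut w S" and ?u = "w_uncut w S"
  define h where "h = cheeger ?c"
  note c_nonneg = maxcut_instance_w_cut(1)[of w S, OF mi]
    and c_sym = maxcut_instance_w_cut(2)[of w S, OF mi]
    and u_nonneg = maxcut_instance_w_uncut(1)[of w S, OF mi]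
    and u_sym = maxcut_instance_w_uncut(2)[of w S, OF mi]
  have "i \<noteq> j"
    using nonconst by blast
  then have singleton_proper: "{k} \<noteq> UNIV" for k :: 'n
    by (metis UNIV_I singletonD)
  have tau_pos: "0 < tau ?c A" if "A \<noteq> {}" "A \<noteq> UNIV" for A
    using tau_w_cut_pos[OF mi mc that] .
  have wdeg_pos: "0 < wdeg ?c k" for k
  proof -
    have "0 < tau ?c {k}"
      using tau_pos singleton_proper by blast
    also have "tau ?c {k} \<le> wdeg ?c k"
      unfolding tau_def wdeg_def using c_nonneg by (simp add: sum_mono2)
    finally show ?thesis .
  qed
  have "0 < h"
    unfolding h_def using cheeger_pos[of ?c "{i}", OF c_nonneg tau_pos] singleton_proper by blast
  then have "sqrt (1 - h\<^sup>2) < 1"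
    by (simp add: real_sqrt_less_iff)
  then have "2 < \<gamma> * (1 - sqrt (1 - h\<^sup>2))"
    using gamma_large by (simp add: h_def pos_divide_less_eq)
  moreover have "\<gamma> * wdeg ?u k \<le> wdeg ?c k" for k
    using xi_ge[of k] by (simp add: xi_def iota_def wdeg_def)
  ultimately have "(\<Sum>k\<in>UNIV. \<Sum>l\<in>UNIV. ?u k l * (cut_sign S k * v $ k - cut_sign S l * v $ l)\<^sup>2)
      < (\<Sum>k\<in>UNIV. \<Sum>l\<in>UNIV. ?c k l * (cut_sign S k * v $ k - cut_sign S l * v $ l)\<^sup>2)"
    using nonconst \<open>0 < h\<close> cheeger_mult_min_mu_le_tau[of ?c, OF c_nonneg]
    by (intro sum_sq_diff_lt_of_cheeger[of ?c ?u h, OF c_nonneg c_sym u_nonneg u_sym])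
      (auto simp: h_def wdeg_pos)
  then show ?thesis
    using wmat_Dprime_quadratic_form[of w "\<lambda>k. cut_sign S k * v $ k" S v] mi
    by (simp add: maxcut_instance_def)
qed

theorem lemma2:
  fixes w :: "'n::finite \<Rightarrow> 'n \<Rightarrow> real" and S :: "'n set" and \<gamma> :: real
  assumes "maxcut_instance w"
    and "is_max_cut w S"
    and "\<And>x. xi w S x \<ge> \<gamma> * iota w S x"
    and "\<gamma> > 2 / (1 - sqrt (1 - (cheeger (w_cut w S))\<^sup>2))"
  shows "psd (wmat w + Dprime w S) \<and> rank (wmat w + Dprime w S) = CARD('n) - 1"
proof -
  define M where "M = wmat w + Dprime w S"
  define s :: "real^'n" where "s = (\<chi> i. cut_sign S i)"
  have Ms: "M *v s = 0"
    unfolding M_def s_def by (rule wmat_Dprime_mult_cut_sign)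
  have span_or_pos: "v \<in> span {s} \<or> 0 < v \<bullet> (M *v v)" for v
    using wmat_Dprime_quadratic_form_pos[OF assms] mem_span_cut_sign[of S v]
    unfolding M_def s_def by blast
  have "0 \<le> v \<bullet> (M *v v)" for v
    using span_or_pos[of v] Ms by (auto simp: span_singleton matrix_vector_mult_scaleR)
  moreover have "rank M = CARD('n) - 1"
  proof (rule rank_eq_card_minus_one_if_kernel_line[OF _ _ Ms])
    show "transpose M = M"
      using assms(1) unfolding M_def by (intro transpose_wmat_Dprime) (simp add: maxcut_instance_def)
    show "s \<noteq> 0"
      by (auto simp: s_def vec_eq_iff cut_sign_def)
    show "M *v v = 0 \<Longrightarrow> v \<in> span {s}" for v
      using span_or_pos[of v] by auto
  qed
  ultimately show ?thesis
    by (simp add: psd_def M_def)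
qed

end
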